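(* Let $G$ be a finite group, let $N$ be a normal subgroup of $G$, and let $\theta$ be an irreducible complex character of $N$ such that the dual character $\overline\theta$ is $G$-conjugate to $\theta$. Then the Frobenius-Schur indicator $\epsilon(\theta{\uparrow^G})$ of the induced character $\theta{\uparrow^G}$ equals the number of $+1$ type involutions in $G_\theta^*/N$ minus the number of $-1$ type involutions in $G_\theta^*/N$.
   Context: For $g\in G$, $\theta^g$ is the conjugate character of $N$ given by $\theta^g(n^g)=\theta(n)$, where $n^g=g^{-1}ng$; $\overline\theta$ is the complex conjugate character. The extended inertia group of $\theta$ in $G$ is $G_\theta^*=\{g\in G\mid \theta^g=\theta\text{ or }\theta^g=\overline\theta\}$. The Frobenius-Schur indicator of a character $\chi$ of a finite group $H$ is $\epsilon(\chi)=\frac{1}{|H|}\sum_{h\in H}\chi(h^2)$ (it is linear in $\chi$). Convention: an involution means a group element of order $1$ or $2$ (so the identity counts as an involution). For $t\in G$ with $t^2\in N$, the Gow indicator of $\theta$ with respect to $t$ is $\epsilon_t(\theta)=\frac{1}{|N|}\sum_{n\in N}\theta((nt)^2)$. It depends only on the coset $\overline t=tN$ and it takes values in $\{0,+1,-1\}$. An involution $\overline t\in G/N$ is said to be of $+1$, $-1$ or $0$ type (for $\theta$) according to whether $\epsilon_t(\theta)$ is $+1$, $-1$ or $0$. *)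

theory Defs
  imports "Jordan_Normal_Form.VS_Connect"
begin

text \<open>A representation of degree \<open>n\<close> is a homomorphism into \<open>GL\<^sub>n(\<complex>)\<close>, realised as the unit group
  of the matrix ring.\<close>

definition mat_rep :: "('a, 'b) monoid_scheme \<Rightarrow> nat \<Rightarrow> ('a \<Rightarrow> complex mat) \<Rightarrow> bool" where
  "mat_rep H n \<rho> \<longleftrightarrow> \<rho> \<in> hom H (units_of (ring_mat TYPE(complex) n ()))"

definition irreducible_mat_rep :: "('a, 'b) monoid_scheme \<Rightarrow> nat \<Rightarrow> ('a \<Rightarrow> complex mat) \<Rightarrow> bool" where
  "irreducible_mat_rep H n \<rho> \<longleftrightarrow>
     mat_rep H n \<rho> \<and> n > 0 \<and>
     (\<forall>W. VectorSpace.subspace class_ring W (module_vec TYPE(complex) n) \<and>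
          (\<forall>h\<in>carrier H. \<forall>w\<in>W. \<rho> h *\<^sub>v w \<in> W)
        \<longrightarrow> W = {0\<^sub>v n} \<or> W = carrier_vec n)"

definition mat_trace :: "'r::comm_monoid_add mat \<Rightarrow> 'r" where
  "mat_trace A = (\<Sum>i<dim_row A. A $$ (i, i))"

text \<open>Characters of \<open>H\<close> are functions on the ambient type of which only the values on \<open>carrier H\<close>
  matter; accordingly characters are always compared pointwise on the carrier below.\<close>

definition irreducible_character :: "('a, 'b) monoid_scheme \<Rightarrow> ('a \<Rightarrow> complex) \<Rightarrow> bool" where
  "irreducible_character H \<chi> \<longleftrightarrow>
     (\<exists>n \<rho>. irreducible_mat_rep H n \<rho> \<and> (\<forall>h\<in>carrier H. \<chi> h = mat_trace (\<rho> h)))"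

text \<open>The defining property is \<open>\<theta>\<^sup>g(g\<inverse> n g) = \<theta>(n)\<close>, that is, \<open>\<theta>\<^sup>g(n) = \<theta>(g n g\<inverse>)\<close>.\<close>

definition conj_char :: "('a, 'b) monoid_scheme \<Rightarrow> ('a \<Rightarrow> complex) \<Rightarrow> 'a \<Rightarrow> 'a \<Rightarrow> complex" where
  "conj_char G \<theta> g n = \<theta> (g \<otimes>\<^bsub>G\<^esub> n \<otimes>\<^bsub>G\<^esub> inv\<^bsub>G\<^esub> g)"

lemma (in group) conj_char_conj:
  "\<lbrakk>g \<in> carrier G; n \<in> carrier G\<rbrakk> \<Longrightarrow> conj_char G \<theta> g (inv g \<otimes> n \<otimes> g) = \<theta> n"
  using m_assoc[of g "inv g" n] by (simp add: conj_char_def m_assoc)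

definition ext_inertia :: "('a, 'b) monoid_scheme \<Rightarrow> 'a set \<Rightarrow> ('a \<Rightarrow> complex) \<Rightarrow> 'a set" where
  "ext_inertia G N \<theta> =
     {g \<in> carrier G. (\<forall>n\<in>N. conj_char G \<theta> g n = \<theta> n) \<or> (\<forall>n\<in>N. conj_char G \<theta> g n = cnj (\<theta> n))}"

text \<open>The character \<open>\<theta>\<close> of the subgroup \<open>N\<close> is extended by zero to \<open>G\<close> and averaged.\<close>

definition induced_char ::
    "('a, 'b) monoid_scheme \<Rightarrow> 'a set \<Rightarrow> ('a \<Rightarrow> complex) \<Rightarrow> 'a \<Rightarrow> complex" where
  "induced_char G N \<theta> g =
     (\<Sum>x\<in>carrier G. let y = x \<otimes>\<^bsub>G\<^esub> g \<otimes>\<^bsub>G\<^esub> inv\<^bsub>G\<^esub> x in if y \<in> N then \<theta> y else 0) / of_nat (card N)"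

definition fs_indicator :: "('a, 'b) monoid_scheme \<Rightarrow> ('a \<Rightarrow> complex) \<Rightarrow> complex" where
  "fs_indicator H \<chi> = (\<Sum>h\<in>carrier H. \<chi> (h [^]\<^bsub>H\<^esub> (2::nat))) / of_nat (card (carrier H))"

definition gow_indicator ::
    "('a, 'b) monoid_scheme \<Rightarrow> 'a set \<Rightarrow> ('a \<Rightarrow> complex) \<Rightarrow> 'a \<Rightarrow> complex" where
  "gow_indicator G N \<theta> t =
     (\<Sum>n\<in>N. \<theta> ((n \<otimes>\<^bsub>G\<^esub> t) [^]\<^bsub>G\<^esub> (2::nat))) / of_nat (card N)"

lemma (in group) gow_indicator_coset:
  assumes N: "subgroup N G" and t: "t \<in> carrier G" and m: "m \<in> N"
  shows "gow_indicator G N \<theta> (m \<otimes> t) = gow_indicator G N \<theta> t"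
proof -
  interpret subgroup N G by (rule N)
  have "(\<Sum>n\<in>N. \<theta> ((n \<otimes> (m \<otimes> t)) [^] (2::nat))) = (\<Sum>n\<in>N. \<theta> ((n \<otimes> t) [^] (2::nat)))"
    by (rule sum.reindex_bij_witness[of _ "\<lambda>n. n \<otimes> inv m" "\<lambda>n. n \<otimes> m"])
       (use m t in \<open>auto simp: m_assoc\<close>)
  then show ?thesis
    by (simp add: gow_indicator_def)
qed

text \<open>The involutions of type \<open>\<epsilon>\<close> in \<open>K/N\<close>, where \<open>N \<subseteq> K \<subseteq> G\<close> and the identity coset counts as an
  involution. By \<open>gow_indicator_coset\<close> the choice of the representative \<open>t\<close> is immaterial.\<close>

definition typed_involutions ::
    "('a, 'b) monoid_scheme \<Rightarrow> 'a set \<Rightarrow> ('a \<Rightarrow> complex) \<Rightarrow> 'a set \<Rightarrow> complex \<Rightarrow> 'a set set" where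
  "typed_involutions G N \<theta> K \<epsilon> =
     {T \<in> carrier (G\<lparr>carrier := K\<rparr> Mod N).
        T [^]\<^bsub>G\<lparr>carrier := K\<rparr> Mod N\<^esub> (2::nat) = \<one>\<^bsub>G\<lparr>carrier := K\<rparr> Mod N\<^esub> \<and>
        (\<exists>t\<in>T. gow_indicator G N \<theta> t = \<epsilon>)}"

end

theory Submission
  imports Defs "Jordan_Normal_Form.Spectral_Radius"
begin

text \<open>Inserting the definition of the induced character and using that squaring commutes with
  conjugation, one finds that \<open>\<epsilon>(\<theta>\<up>\<^sup>G)\<close> is \<open>1/|N|\<close> times the sum of \<open>\<theta>(g\<^sup>2)\<close> over all \<open>g\<close> with
  \<open>g\<^sup>2 \<in> N\<close>. These \<open>g\<close> fill whole cosets of \<open>N\<close>, namely the involutions \<open>Nt\<close> of \<open>G/N\<close>, and each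
  such coset contributes precisely the Gow indicator \<open>\<epsilon>\<^sub>t(\<theta>)\<close>. The theorem is therefore the sum of two
  facts about a single involution \<open>Nt\<close>: the value \<open>\<epsilon>\<^sub>t(\<theta>)\<close> is \<open>0\<close>, \<open>1\<close> or \<open>- 1\<close>, and if it is not \<open>0\<close>
  then \<open>t\<close> lies in the extended inertia group (\<open>gow_indicator_nonzero\<close>).

  Both facts only concern \<open>N\<close>, the automorphism \<open>\<alpha>(n) = tnt\<inverse>\<close> and the element \<open>s = t\<^sup>2\<close>, because
  \<open>(nt)\<^sup>2 = n \<alpha>(n) s\<close>. They are the content of \<open>twisted_frobenius_schur\<close>, which is the theorem of
  Frobenius and Schur with a twist (the classical case is \<open>\<alpha> = id\<close>, \<open>s = 1\<close>). Let \<open>\<rho>\<close> afford \<open>\<theta>\<close>. If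
  the sum of \<open>\<theta>(n \<alpha>(n) s)\<close> does not vanish, then averaging a suitable matrix unit gives a nonzero
  intertwiner \<open>B\<close> from \<open>\<rho> \<circ> \<alpha>\<close> to the dual of \<open>\<rho>\<close>, which is invertible by Schur's lemma. Hence
  \<open>\<theta>(\<alpha>(n)) = \<theta>(n\<inverse>)\<close>, and \<open>\<theta>(n\<inverse>)\<close> is the complex conjugate of \<open>\<theta>(n)\<close>. Substituting
  \<open>\<rho>(\<alpha>(n)) = B\<inverse> \<rho>(n\<inverse>)\<^sup>T B\<close> and applying Schur orthogonality, the sum becomes a multiple of the trace
  of \<open>D = B\<^sup>-\<^sup>T B \<rho>(s)\<close>. As \<open>\<alpha>\<^sup>2\<close> is conjugation by \<open>s\<close>, the matrix \<open>D\<close> commutes with \<open>\<rho>\<close> and is a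
  scalar \<open>c\<close>, equal to the indicator. Finally \<open>\<alpha>(s) = s\<close> makes the twisted transposition of \<open>B\<close>,
  which is multiplication by \<open>c\<close>, an involution, so \<open>c\<^sup>2 = 1\<close>.\<close>

section \<open>Sums and traces of matrices, and matrix units\<close>

text \<open>Matrices of all sizes share one type, whose addition has no neutral element, so that the
  generic sum over a set is not available for them; the size is therefore a parameter here.\<close>

definition mat_sum :: "nat \<Rightarrow> 'i set \<Rightarrow> ('i \<Rightarrow> 'r::comm_ring_1 mat) \<Rightarrow> 'r mat" where
  "mat_sum d I F = mat d d (\<lambda>(i, j). \<Sum>a\<in>I. F a $$ (i, j))"

lemma mat_sum_carrier [simp]: "mat_sum d I F \<in> carrier_mat d d"
  and mat_sum_dim [simp]: "dim_row (mat_sum d I F) = d" "dim_col (mat_sum d I F) = d"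
  by (simp_all add: mat_sum_def)

lemma mat_sum_index [simp]:
  "i < d \<Longrightarrow> j < d \<Longrightarrow> mat_sum d I F $$ (i, j) = (\<Sum>a\<in>I. F a $$ (i, j))"
  by (simp add: mat_sum_def)

lemma mat_sum_cong: "(\<And>a. a \<in> I \<Longrightarrow> F a = F' a) \<Longrightarrow> mat_sum d I F = mat_sum d I F'"
  by (simp add: mat_sum_def)

lemma mult_index:
  assumes "A \<in> carrier_mat n m" "B \<in> carrier_mat m k" "i < n" "j < k"
  shows "(A * B) $$ (i, j) = (\<Sum>l<m. A $$ (i, l) * B $$ (l, j))"
  using assms by (simp add: scalar_prod_def lessThan_atLeast0)

lemma mult_mat_sum:
  assumes "A \<in> carrier_mat d d" "\<And>a. a \<in> I \<Longrightarrow> F a \<in> carrier_mat d d"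
  shows "A * mat_sum d I F = mat_sum d I (\<lambda>a. A * F a)"
proof (rule eq_matI)
  fix i j assume "i < dim_row (mat_sum d I (\<lambda>a. A * F a))" "j < dim_col (mat_sum d I (\<lambda>a. A * F a))"
  then have ij: "i < d" "j < d" by simp_all
  have "(A * mat_sum d I F) $$ (i, j) = (\<Sum>l<d. A $$ (i, l) * (\<Sum>a\<in>I. F a $$ (l, j)))"
    using ij by (simp add: mult_index[OF assms(1) mat_sum_carrier])
  also have "\<dots> = (\<Sum>a\<in>I. \<Sum>l<d. A $$ (i, l) * F a $$ (l, j))"
    by (simp add: sum_distrib_left sum.swap[of _ I])
  also have "\<dots> = (\<Sum>a\<in>I. (A * F a) $$ (i, j))"
    by (intro sum.cong refl) (simp add: mult_index[OF assms(1,2)] ij)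
  finally show "(A * mat_sum d I F) $$ (i, j) = mat_sum d I (\<lambda>a. A * F a) $$ (i, j)"
    using ij by simp
qed (use assms in auto)

lemma mat_sum_mult:
  assumes "A \<in> carrier_mat d d" "\<And>a. a \<in> I \<Longrightarrow> F a \<in> carrier_mat d d"
  shows "mat_sum d I F * A = mat_sum d I (\<lambda>a. F a * A)"
proof (rule eq_matI)
  fix i j assume "i < dim_row (mat_sum d I (\<lambda>a. F a * A))" "j < dim_col (mat_sum d I (\<lambda>a. F a * A))"
  then have ij: "i < d" "j < d" by simp_all
  have "(mat_sum d I F * A) $$ (i, j) = (\<Sum>l<d. (\<Sum>a\<in>I. F a $$ (i, l)) * A $$ (l, j))"
    using ij by (simp add: mult_index[OF mat_sum_carrier assms(1)])
  also have "\<dots> = (\<Sum>a\<in>I. \<Sum>l<d. F a $$ (i, l) * A $$ (l, j))"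
    by (simp add: sum_distrib_right sum.swap[of _ I])
  also have "\<dots> = (\<Sum>a\<in>I. (F a * A) $$ (i, j))"
    by (intro sum.cong refl) (simp add: mult_index[OF assms(2,1)] ij)
  finally show "(mat_sum d I F * A) $$ (i, j) = mat_sum d I (\<lambda>a. F a * A) $$ (i, j)"
    using ij by simp
qed (use assms in auto)

lemma mat_trace_mat_sum:
  assumes "\<And>a. a \<in> I \<Longrightarrow> F a \<in> carrier_mat d d"
  shows "mat_trace (mat_sum d I F) = (\<Sum>a\<in>I. mat_trace (F a))"
proof -
  have "mat_trace (mat_sum d I F) = (\<Sum>a\<in>I. \<Sum>i<d. F a $$ (i, i))"
    by (simp add: mat_trace_def sum.swap[of _ I])
  also have "\<dots> = (\<Sum>a\<in>I. mat_trace (F a))"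
    by (intro sum.cong refl) (use assms in \<open>auto simp: mat_trace_def dest!: assms\<close>)
  finally show ?thesis .
qed

lemma mat_trace_mult_comm:
  fixes A B :: "'r::comm_ring_1 mat"
  assumes "A \<in> carrier_mat n m" "B \<in> carrier_mat m n"
  shows "mat_trace (A * B) = mat_trace (B * A)"
proof -
  have "mat_trace (A * B) = (\<Sum>i<n. \<Sum>j<m. A $$ (i, j) * B $$ (j, i))"
    using assms by (auto simp: mat_trace_def mult_index[OF assms] intro!: sum.cong simp del: index_mult_mat(1))
  also have "\<dots> = (\<Sum>j<m. \<Sum>i<n. B $$ (j, i) * A $$ (i, j))"
    by (subst sum.swap) (simp add: mult.commute)
  also have "\<dots> = mat_trace (B * A)"
    using assms by (auto simp: mat_trace_def mult_index[OF assms(2,1)] intro!: sum.cong simp del: index_mult_mat(1))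
  finally show ?thesis .
qed

lemma mat_trace_transpose: "A \<in> carrier_mat n n \<Longrightarrow> mat_trace A\<^sup>T = mat_trace A"
  by (simp add: mat_trace_def)

lemma mat_trace_similar:
  fixes A :: "'r::comm_ring_1 mat"
  assumes A: "A \<in> carrier_mat n n" and A': "A' \<in> carrier_mat n n" and inv: "A * A' = 1\<^sub>m n" and inv': "A' * A = 1\<^sub>m n"
    and S: "S \<in> carrier_mat n n" and T: "T \<in> carrier_mat n n" and eq: "S * A = A * T"
  shows "mat_trace S = mat_trace T"
proof -
  have "S = S * A * A'" unfolding assoc_mult_mat[OF S A A'] inv using S by simp
  then have "mat_trace S = mat_trace (A * T * A')" using eq by simp
  also have "\<dots> = mat_trace (A' * (A * T))"
    by (rule mat_trace_mult_comm[of _ n n]) (use A A' T in auto)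
  also have "A' * (A * T) = T" using assms by (simp flip: assoc_mult_mat[OF A' A T])
  finally show ?thesis .
qed

definition unit_mat :: "nat \<Rightarrow> nat \<Rightarrow> nat \<Rightarrow> 'r::comm_ring_1 mat" where
  "unit_mat d p q = mat d d (\<lambda>(i, j). if i = p \<and> j = q then 1 else 0)"

lemma unit_mat_carrier [simp]: "unit_mat d p q \<in> carrier_mat d d"
  by (simp add: unit_mat_def)

lemma mult_unit_mat_index:
  fixes A B :: "'r::comm_ring_1 mat"
  assumes A: "A \<in> carrier_mat d d" and B: "B \<in> carrier_mat d d"
    and "p < d" "q < d" "a < d" "b < d"
  shows "(A * unit_mat d p q * B) $$ (a, b) = A $$ (a, p) * B $$ (q, b)"
proof -
  have AE: "(A * unit_mat d p q) $$ (a, l) = (if l = q then A $$ (a, p) else 0)" if "l < d" for l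
  proof -
    have "(A * unit_mat d p q) $$ (a, l) = (\<Sum>k<d. A $$ (a, k) * unit_mat d p q $$ (k, l))"
      by (rule mult_index[OF A unit_mat_carrier]) fact+
    also have "\<dots> = (\<Sum>k<d. if k = p then (if l = q then A $$ (a, p) else 0) else 0)"
      by (intro sum.cong) (use that in \<open>auto simp: unit_mat_def\<close>)
    finally show ?thesis using \<open>p < d\<close> by simp
  qed
  have "(A * unit_mat d p q * B) $$ (a, b) = (\<Sum>l<d. (A * unit_mat d p q) $$ (a, l) * B $$ (l, b))"
    by (rule mult_index[OF mult_carrier_mat[OF A unit_mat_carrier] B]) fact+
  also have "\<dots> = (\<Sum>l<d. if l = q then A $$ (a, p) * B $$ (q, b) else 0)"
    by (intro sum.cong) (auto simp: AE simp del: index_mult_mat(1))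
  finally show ?thesis using \<open>q < d\<close> by simp
qed

lemma mat_trace_unit_mat:
  assumes "p < d" "q < d"
  shows "mat_trace (unit_mat d p q) = (if p = q then 1 else 0)"
proof -
  have "mat_trace (unit_mat d p q :: 'a mat) = (\<Sum>i<d. if i = p then (if p = q then 1 else 0) else 0)"
    unfolding mat_trace_def by (intro sum.cong) (auto simp: unit_mat_def)
  then show ?thesis using assms by simp
qed

section \<open>Matrix representations\<close>

lemma mat_rep_iff:
  assumes "group H"
  shows "mat_rep H d \<rho> \<longleftrightarrow>
    (\<forall>h\<in>carrier H. \<rho> h \<in> carrier_mat d d) \<and>
    (\<forall>g\<in>carrier H. \<forall>h\<in>carrier H. \<rho> (g \<otimes>\<^bsub>H\<^esub> h) = \<rho> g * \<rho> h) \<and> \<rho> \<one>\<^bsub>H\<^esub> = 1\<^sub>m d"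
    (is "_ \<longleftrightarrow> ?R")
proof -
  let ?M = "ring_mat TYPE(complex) d ()"
  interpret H: group H by fact
  interpret M: monoid ?M
    by (rule ring.is_monoid[OF ring_mat])
  note [simp] = ring_mat_simps
  show ?thesis
  proof
    assume "mat_rep H d \<rho>"
    then have hom: "\<rho> \<in> hom H (units_of ?M)" by (simp add: mat_rep_def)
    then interpret group_hom H "units_of ?M" \<rho>
      by (intro group_hom.intro H.group_axioms M.units_group group_hom_axioms.intro)
    show ?R
    proof (intro conjI ballI)
      show "\<rho> h \<in> carrier_mat d d" if "h \<in> carrier H" for h
        using hom_closed[OF that] M.Units_closed by (simp add: units_of_carrier)
      show "\<rho> (g \<otimes>\<^bsub>H\<^esub> h) = \<rho> g * \<rho> h" if "g \<in> carrier H" "h \<in> carrier H" for g h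
        using hom_mult[OF that] by (simp add: units_of_mult)
      show "\<rho> \<one>\<^bsub>H\<^esub> = 1\<^sub>m d"
        using hom_one by (simp add: units_of_one)
    qed
  next
    assume R: ?R
    have "\<rho> h \<in> Units ?M" if h: "h \<in> carrier H" for h
    proof -
      have "\<rho> (inv\<^bsub>H\<^esub> h) * \<rho> h = 1\<^sub>m d" "\<rho> h * \<rho> (inv\<^bsub>H\<^esub> h) = 1\<^sub>m d"
        using R[THEN conjunct2, THEN conjunct1, rule_format, of "inv\<^bsub>H\<^esub> h" h, symmetric]
          R[THEN conjunct2, THEN conjunct1, rule_format, of h "inv\<^bsub>H\<^esub> h", symmetric]
          R[THEN conjunct2, THEN conjunct2] h
        by simp_all
      moreover have "\<rho> h \<in> carrier_mat d d" "\<rho> (inv\<^bsub>H\<^esub> h) \<in> carrier_mat d d"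
        using R h by simp_all
      ultimately show ?thesis
        unfolding Units_def by auto
    qed
    then show "mat_rep H d \<rho>"
      using R by (simp add: mat_rep_def hom_def units_of_def Pi_iff)
  qed
qed

lemma subspace_module_vecI:
  assumes W: "W \<subseteq> carrier_vec d" "0\<^sub>v d \<in> W"
    and add: "\<And>v w. v \<in> W \<Longrightarrow> w \<in> W \<Longrightarrow> v + w \<in> W"
    and smult: "\<And>(c::complex) v. v \<in> W \<Longrightarrow> c \<cdot>\<^sub>v v \<in> W"
  shows "VectorSpace.subspace class_ring W (module_vec TYPE(complex) d)"
proof -
  interpret vec_space "TYPE(complex)" d .
  show ?thesis
  proof (rule VectorSpace.subspace.intro)
    show "vectorspace class_ring V" by unfold_locales
    show "submodule class_ring W V"
      by unfold_locales (use assms in \<open>auto simp: module_vec_simps\<close>)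
  qed
qed

context group
begin

lemma mat_rep_carrier: "mat_rep G d \<rho> \<Longrightarrow> h \<in> carrier G \<Longrightarrow> \<rho> h \<in> carrier_mat d d"
  and mat_rep_mult: "mat_rep G d \<rho> \<Longrightarrow> g \<in> carrier G \<Longrightarrow> h \<in> carrier G \<Longrightarrow> \<rho> (g \<otimes> h) = \<rho> g * \<rho> h"
  and mat_rep_one: "mat_rep G d \<rho> \<Longrightarrow> \<rho> \<one> = 1\<^sub>m d"
  using mat_rep_iff[OF group_axioms, of d \<rho>] by auto

lemma mat_rep_dual:
  assumes "mat_rep G d \<rho>"
  shows "mat_rep G d (\<lambda>h. (\<rho> (inv h))\<^sup>T)"
  unfolding mat_rep_iff[OF group_axioms]
proof (intro conjI ballI)
  fix g h assume gh: "g \<in> carrier G" "h \<in> carrier G"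
  then show "(\<rho> (inv (g \<otimes> h)))\<^sup>T = (\<rho> (inv g))\<^sup>T * (\<rho> (inv h))\<^sup>T"
    by (simp add: inv_mult_group mat_rep_mult[OF assms]
        transpose_mult[OF mat_rep_carrier[OF assms] mat_rep_carrier[OF assms]])
qed (simp_all add: mat_rep_carrier[OF assms] mat_rep_one[OF assms])

lemma mat_rep_cnj:
  assumes "mat_rep G d \<rho>"
  shows "mat_rep G d (\<lambda>h. map_mat cnj (\<rho> h))"
  unfolding mat_rep_iff[OF group_axioms]
proof (intro conjI ballI)
  fix g h assume gh: "g \<in> carrier G" "h \<in> carrier G"
  have c: "\<rho> g \<in> carrier_mat d d" "\<rho> h \<in> carrier_mat d d"
    using gh by (auto intro: mat_rep_carrier[OF assms])
  show "map_mat cnj (\<rho> (g \<otimes> h)) = map_mat cnj (\<rho> g) * map_mat cnj (\<rho> h)"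
    using c by (intro eq_matI) (auto simp: mat_rep_mult[OF assms gh] scalar_prod_def)
qed (auto simp: mat_rep_carrier[OF assms] mat_rep_one[OF assms])

text \<open>A surjective twist leaves the set of representing matrices unchanged, hence also the invariant
  subspaces.\<close>

lemma irreducible_mat_rep_comp:
  assumes irr: "irreducible_mat_rep G d \<rho>"
    and hom: "\<alpha> \<in> hom G G" and surj: "\<alpha> ` carrier G = carrier G"
  shows "irreducible_mat_rep G d (\<rho> \<circ> \<alpha>)"
proof -
  interpret \<alpha>: group_hom G G \<alpha>
    by unfold_locales fact
  have rep: "mat_rep G d \<rho>" using irr by (simp add: irreducible_mat_rep_def)
  have "mat_rep G d (\<rho> \<circ> \<alpha>)"
    unfolding mat_rep_iff[OF group_axioms]
    by (simp add: mat_rep_carrier[OF rep] mat_rep_mult[OF rep] mat_rep_one[OF rep])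
  moreover have "(\<forall>h\<in>carrier G. \<forall>w\<in>W. (\<rho> \<circ> \<alpha>) h *\<^sub>v w \<in> W) \<longleftrightarrow>
      (\<forall>h\<in>carrier G. \<forall>w\<in>W. \<rho> h *\<^sub>v w \<in> W)" for W
    by (subst (2) surj[symmetric]) simp
  ultimately show ?thesis
    using irr unfolding irreducible_mat_rep_def by simp
qed

section \<open>Schur's lemma and orthogonality\<close>

text \<open>The kernel of an intertwiner \<open>A\<close> is invariant under \<open>T\<close>, so it is zero by irreducibility unless
  \<open>A = 0\<close>; for square matrices injectivity is invertibility.\<close>

theorem schur_isomorphism:
  assumes irr: "irreducible_mat_rep G d T" and A: "A \<in> carrier_mat d d"
    and S: "\<And>h. h \<in> carrier G \<Longrightarrow> S h \<in> carrier_mat d d"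
    and eq: "\<And>h. h \<in> carrier G \<Longrightarrow> S h * A = A * T h"
    and nz: "A \<noteq> 0\<^sub>m d d"
  obtains A' where "A' \<in> carrier_mat d d" "A * A' = 1\<^sub>m d" "A' * A = 1\<^sub>m d"
proof -
  have rep: "mat_rep G d T" using irr by (simp add: irreducible_mat_rep_def)
  define W where "W = {v \<in> carrier_vec d. A *\<^sub>v v = 0\<^sub>v d}"
  have sub: "VectorSpace.subspace class_ring W (module_vec TYPE(complex) d)"
    by (rule subspace_module_vecI)
       (use A in \<open>auto simp: W_def mult_add_distrib_mat_vec[OF A] mult_mat_vec[OF A]\<close>)
  have stable: "T h *\<^sub>v w \<in> W" if h: "h \<in> carrier G" and w: "w \<in> W" for h w
  proof -
    have c: "T h \<in> carrier_mat d d" "S h \<in> carrier_mat d d" "w \<in> carrier_vec d"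
      using h w S mat_rep_carrier[OF rep] by (auto simp: W_def)
    have "A *\<^sub>v (T h *\<^sub>v w) = S h *\<^sub>v (A *\<^sub>v w)"
      using c A eq[OF h] by (metis assoc_mult_mat_vec)
    also have "\<dots> = 0\<^sub>v d"
      using w c by (auto simp: W_def)
    finally show ?thesis using c by (simp add: W_def)
  qed
  have "W \<noteq> carrier_vec d"
  proof
    assume "W = carrier_vec d"
    then have Aj: "A *\<^sub>v unit_vec d j = 0\<^sub>v d" for j
      unfolding W_def using unit_vec_carrier[of d j] by blast
    have "A = 0\<^sub>m d d"
    proof (rule eq_matI)
      fix i j assume ij: "i < dim_row (0\<^sub>m d d :: complex mat)" "j < dim_col (0\<^sub>m d d :: complex mat)"
      then have "A $$ (i, j) = (A *\<^sub>v unit_vec d j) $ i"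
        using A by (simp add: scalar_prod_right_unit)
      also have "\<dots> = 0"
        using ij unfolding Aj by simp
      finally show "A $$ (i, j) = 0\<^sub>m d d $$ (i, j)"
        using ij by simp
    qed (use A in auto)
    with nz show False ..
  qed
  then have "W = {0\<^sub>v d}"
    using irr sub stable by (auto simp: irreducible_mat_rep_def)
  then have "det A \<noteq> 0"
    using det_0_iff_vec_prod_zero[OF A] by (auto simp: W_def)
  from det_non_zero_imp_unit[OF A this] obtain A' where
    "A' \<in> carrier_mat d d" "A * A' = 1\<^sub>m d" "A' * A = 1\<^sub>m d"
    by (auto simp: Units_def ring_mat_simps)
  then show ?thesis by (rule that)
qed

text \<open>Subtracting an eigenvalue \<open>c\<close> from \<open>A\<close> leaves a singular intertwiner, which must vanish.\<close>

theorem schur_scalar: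
  assumes irr: "irreducible_mat_rep G d T" and A: "A \<in> carrier_mat d d"
    and comm: "\<And>h. h \<in> carrier G \<Longrightarrow> T h * A = A * T h"
  obtains c where "A = c \<cdot>\<^sub>m 1\<^sub>m d"
proof -
  have rep: "mat_rep G d T" and d: "d > 0" using irr by (auto simp: irreducible_mat_rep_def)
  obtain c where c: "eigenvalue A c"
    using spectrum_non_empty[OF A d] by (auto simp: spectrum_def)
  define E where "E = A - c \<cdot>\<^sub>m 1\<^sub>m d"
  have E: "E \<in> carrier_mat d d" using A by (auto simp: E_def)
  from c obtain v where v: "v \<in> carrier_vec d" "v \<noteq> 0\<^sub>v d" "A *\<^sub>v v = c \<cdot>\<^sub>v v"
    using A by (auto simp: eigenvalue_def eigenvector_def)
  have "(c \<cdot>\<^sub>m 1\<^sub>m d) *\<^sub>v v = c \<cdot>\<^sub>v v"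
    using v(1) by (intro eq_vecI) (auto simp: row_smult scalar_prod_left_unit)
  then have Ev: "E *\<^sub>v v = 0\<^sub>v d"
    using v A by (simp add: E_def minus_mult_distrib_mat_vec[OF A, of "c \<cdot>\<^sub>m 1\<^sub>m d"])
  have "E = 0\<^sub>m d d"
  proof (rule ccontr)
    assume nz: "E \<noteq> 0\<^sub>m d d"
    have "T h * E = E * T h" if "h \<in> carrier G" for h
    proof -
      have T: "T h \<in> carrier_mat d d" using that by (rule mat_rep_carrier[OF rep])
      show ?thesis
        using comm[OF that] T A
        by (simp add: E_def mult_minus_distrib_mat[OF T A] minus_mult_distrib_mat[OF A _ T]
            mult_smult_distrib[OF T one_carrier_mat] mult_smult_assoc_mat[OF one_carrier_mat T])
    qed
    from schur_isomorphism[OF irr E mat_rep_carrier[OF rep] this nz]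
    obtain E' where E': "E' \<in> carrier_mat d d" "E' * E = 1\<^sub>m d" by auto
    have "v = E' *\<^sub>v (E *\<^sub>v v)"
      using v E' E by (simp flip: assoc_mult_mat_vec[OF E'(1) E v(1)])
    then show False using Ev v E' by auto
  qed
  then have "A = c \<cdot>\<^sub>m 1\<^sub>m d"
  proof (intro eq_matI)
    fix i j assume ij: "i < dim_row (c \<cdot>\<^sub>m 1\<^sub>m d)" "j < dim_col (c \<cdot>\<^sub>m 1\<^sub>m d)"
    then have "E $$ (i, j) = 0" using \<open>E = 0\<^sub>m d d\<close> by simp
    then show "A $$ (i, j) = (c \<cdot>\<^sub>m 1\<^sub>m d) $$ (i, j)"
      using A ij by (simp add: E_def)
  qed (use A in auto)
  then show ?thesis by (rule that)
qed


text \<open>The sum is not divided by the group order: only its intertwining property, its vanishing and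
  its explicit entries matter. The two sides may belong to different representations.\<close>

definition average :: "nat \<Rightarrow> ('a \<Rightarrow> complex mat) \<Rightarrow> complex mat \<Rightarrow> ('a \<Rightarrow> complex mat) \<Rightarrow> complex mat" where
  "average d S X T = mat_sum d (carrier G) (\<lambda>h. S (inv h) * X * T h)"

lemma average_carrier [simp]: "average d S X T \<in> carrier_mat d d"
  by (simp add: average_def)

text \<open>Translating the summation variable by \<open>m\<close> moves \<open>m\<close> from the left factor to the right one.\<close>

lemma average_intertwines:
  assumes S: "mat_rep G d S" and T: "mat_rep G d T" and X: "X \<in> carrier_mat d d"
    and m: "m \<in> carrier G"
  shows "S m * average d S X T = average d S X T * T m"
proof -
  have c: "S h \<in> carrier_mat d d" "T h \<in> carrier_mat d d" if "h \<in> carrier G" for h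
    using that by (auto intro: mat_rep_carrier[OF S] mat_rep_carrier[OF T])
  have "S m * average d S X T = mat_sum d (carrier G) (\<lambda>h. S m * (S (inv h) * X * T h))"
    unfolding average_def using c X m by (intro mult_mat_sum mult_carrier_mat[of _ d d]) auto
  \<comment> \<open>replace the summation variable \<open>h\<close> by \<open>h \<otimes> m\<close>\<close>
  also have "\<dots> = mat_sum d (carrier G) (\<lambda>h. S m * (S (inv (h \<otimes> m)) * X * T (h \<otimes> m)))"
  proof -
    have "bij_betw (\<lambda>h. h \<otimes> m) (carrier G) (carrier G)"
      by (rule bij_betw_byWitness[of _ "\<lambda>h. h \<otimes> inv m"]) (use m in \<open>auto simp: m_assoc\<close>)
    from sum.reindex_bij_betw[OF this, symmetric] show ?thesis
      unfolding mat_sum_def by (intro arg_cong[of _ _ "mat d d"] ext) (auto split: prod.split)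
  qed
  also have "\<dots> = mat_sum d (carrier G) (\<lambda>h. S (inv h) * X * T h * T m)"
  proof (rule mat_sum_cong)
    fix h assume h: "h \<in> carrier G"
    have "S m * (S (inv (h \<otimes> m)) * X * T (h \<otimes> m)) = S m * S (inv (h \<otimes> m)) * X * T (h \<otimes> m)"
      using c[of m] c[of "inv (h \<otimes> m)"] c[of "h \<otimes> m"] h m X
      by (simp add: assoc_mult_mat[of _ d d _ d _ d])
    also have "S m * S (inv (h \<otimes> m)) = S (inv h)"
      using h m by (simp add: inv_mult_group flip: mat_rep_mult[OF S] m_assoc)
    also have "T (h \<otimes> m) = T h * T m"
      using h m by (simp add: mat_rep_mult[OF T])
    finally show "S m * (S (inv (h \<otimes> m)) * X * T (h \<otimes> m)) = S (inv h) * X * T h * T m"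
      unfolding mat_rep_mult[OF T h m]
      using c[of m] c[of "inv h"] c[of h] h m X
      by (simp add: assoc_mult_mat[of _ d d _ d _ d])
  qed
  also have "\<dots> = average d S X T * T m"
    unfolding average_def
    using c X m by (intro mat_sum_mult[symmetric] mult_carrier_mat[of _ d d]) auto
  finally show ?thesis .
qed

text \<open>Averages of matrix units are the sums of products of matrix entries that occur in the
  orthogonality relations.\<close>

lemma average_unit_mat_index:
  assumes S: "mat_rep G d S" and T: "mat_rep G d T" and "p < d" "q < d" "a < d" "b < d"
  shows "average d S (unit_mat d p q) T $$ (a, b) =
    (\<Sum>h\<in>carrier G. S (inv h) $$ (a, p) * T h $$ (q, b))"
  using assms unfolding average_def
  by (auto intro!: sum.cong simp: mult_unit_mat_index[OF mat_rep_carrier[OF S] mat_rep_carrier[OF T]]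
      simp del: index_mult_mat(1))

text \<open>The average of a matrix unit commutes with \<open>\<rho>\<close>, hence is scalar, and the scalar is found by
  comparing traces: every summand is a conjugate of the matrix unit.\<close>

theorem schur_orthogonality:
  assumes irr: "irreducible_mat_rep G d \<rho>" and idx: "a < d" "b < d" "p < d" "q < d"
  shows "(\<Sum>h\<in>carrier G. \<rho> (inv h) $$ (a, p) * \<rho> h $$ (q, b)) =
    (if a = b \<and> p = q then of_nat (card (carrier G)) / of_nat d else 0)"
proof -
  have rep: "mat_rep G d \<rho>" and d: "d > 0" using irr by (auto simp: irreducible_mat_rep_def)
  let ?E = "unit_mat d p q :: complex mat"
  define A where "A = average d \<rho> ?E \<rho>"
  have "\<rho> h * A = A * \<rho> h" if "h \<in> carrier G" for h
    unfolding A_def by (rule average_intertwines[OF rep rep unit_mat_carrier that])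
  then obtain c where c: "A = c \<cdot>\<^sub>m 1\<^sub>m d"
    using schur_scalar[OF irr] by (metis A_def average_carrier)
  have "mat_trace A = (\<Sum>h\<in>carrier G. mat_trace (\<rho> (inv h) * ?E * \<rho> h))"
    unfolding A_def average_def
    by (intro mat_trace_mat_sum mult_carrier_mat[of _ d d] mat_rep_carrier[OF rep]) auto
  also have "\<dots> = (\<Sum>h\<in>carrier G. mat_trace ?E)"
  proof (rule sum.cong[OF refl])
    fix h assume h: "h \<in> carrier G"
    have r: "\<rho> h \<in> carrier_mat d d" "\<rho> (inv h) \<in> carrier_mat d d"
      using h by (auto intro: mat_rep_carrier[OF rep])
    have "mat_trace (\<rho> (inv h) * ?E * \<rho> h) = mat_trace (\<rho> h * (\<rho> (inv h) * ?E))"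
      using r by (intro mat_trace_mult_comm[of _ d d]) auto
    also have "\<rho> h * (\<rho> (inv h) * ?E) = \<rho> h * \<rho> (inv h) * ?E"
      using r by (simp add: assoc_mult_mat[of _ d d _ d _ d])
    also have "\<rho> h * \<rho> (inv h) = 1\<^sub>m d"
      using h by (simp add: mat_rep_one[OF rep] flip: mat_rep_mult[OF rep])
    finally show "mat_trace (\<rho> (inv h) * ?E * \<rho> h) = mat_trace ?E"
      by (simp add: left_mult_one_mat[OF unit_mat_carrier])
  qed
  also have "\<dots> = of_nat (card (carrier G)) * (if p = q then 1 else 0)"
    using idx by (simp add: mat_trace_unit_mat)
  finally have "of_nat d * c = of_nat (card (carrier G)) * (if p = q then 1 else 0)"
    by (simp add: c mat_trace_def)
  then have "c = (if p = q then of_nat (card (carrier G)) / of_nat d else 0)"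
    using d by (auto simp: field_simps)
  then have "A $$ (a, b) = (if a = b \<and> p = q then of_nat (card (carrier G)) / of_nat d else 0)"
    using idx by (simp add: c)
  then show ?thesis
    using average_unit_mat_index[OF rep rep] idx by (simp add: A_def)
qed

text \<open>Averaging the identity matrix produces an invariant Hermitian form \<open>P\<close>, that is, an intertwiner
  from \<open>\<rho>\<close> to the conjugate of its dual. It is nonzero by positivity, so the two representations are
  isomorphic and have the same trace.\<close>

theorem mat_trace_rep_inv:
  assumes fin: "finite (carrier G)" and irr: "irreducible_mat_rep G d \<rho>" and h: "h \<in> carrier G"
  shows "mat_trace (\<rho> (inv h)) = cnj (mat_trace (\<rho> h))"
proof -
  have rep: "mat_rep G d \<rho>" and d: "d > 0" using irr by (auto simp: irreducible_mat_rep_def)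
  have r: "\<rho> g \<in> carrier_mat d d" if "g \<in> carrier G" for g
    using that by (rule mat_rep_carrier[OF rep])
  define S where "S = (\<lambda>g. (map_mat cnj (\<rho> (inv g)))\<^sup>T)"
  have S: "mat_rep G d S"
    unfolding S_def by (rule mat_rep_dual[OF mat_rep_cnj[OF rep]])
  define P where "P = average d S (1\<^sub>m d) \<rho>"
  have P: "P \<in> carrier_mat d d" by (simp add: P_def)
  \<comment> \<open>a single diagonal entry is enough for \<open>P \<noteq> 0\<close>: it is a sum of squared absolute values, and
    the identity element contributes \<open>1\<close>\<close>
  have "P $$ (0, 0) = (\<Sum>g\<in>carrier G. \<Sum>l<d. cnj (\<rho> g $$ (l, 0)) * \<rho> g $$ (l, 0))"
    unfolding P_def average_def using d
  proof (subst mat_sum_index, simp, simp, intro sum.cong refl)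
    fix g assume g: "g \<in> carrier G"
    have "S (inv g) = (map_mat cnj (\<rho> g))\<^sup>T" using g by (simp add: S_def)
    then show "(S (inv g) * 1\<^sub>m d * \<rho> g) $$ (0, 0) = (\<Sum>l<d. cnj (\<rho> g $$ (l, 0)) * \<rho> g $$ (l, 0))"
      using r[OF g] d by (auto simp: mult_index[of _ d d _ d] simp del: index_mult_mat(1) intro!: sum.cong)
  qed
  also have "\<dots> = of_real (\<Sum>g\<in>carrier G. \<Sum>l<d. (cmod (\<rho> g $$ (l, 0)))\<^sup>2)"
    by (simp add: complex_norm_square mult.commute del: of_real_power)
  also have "\<dots> \<noteq> 0"
  proof -
    have "0 < (\<Sum>g\<in>carrier G. \<Sum>l<d. (cmod (\<rho> g $$ (l, 0)))\<^sup>2)"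
    proof (rule sum_pos2[OF fin one_closed])
      show "0 < (\<Sum>l<d. (cmod (\<rho> \<one> $$ (l, 0)))\<^sup>2)"
        by (rule sum_pos2[of _ 0]) (use d in \<open>auto simp: mat_rep_one[OF rep]\<close>)
    qed (auto intro: sum_nonneg)
    then show ?thesis by (metis less_irrefl of_real_eq_0_iff)
  qed
  finally have "P \<noteq> 0\<^sub>m d d" using d by auto
  moreover have comm: "S g * P = P * \<rho> g" if "g \<in> carrier G" for g
    unfolding P_def by (rule average_intertwines[OF S rep _ that]) simp
  ultimately obtain P' where P': "P' \<in> carrier_mat d d" "P * P' = 1\<^sub>m d" "P' * P = 1\<^sub>m d"
    using schur_isomorphism[where S = S, OF irr P mat_rep_carrier[OF S]] by metis
  have "mat_trace (S (inv h)) = mat_trace (\<rho> (inv h))"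
    using h by (intro mat_trace_similar[OF P P' _ _ comm] r mat_rep_carrier[OF S]) auto
  moreover have "mat_trace (S (inv h)) = cnj (mat_trace (\<rho> h))"
    using r[OF h] h by (simp add: S_def mat_trace_def)
  ultimately show ?thesis by simp
qed


section \<open>The twisted Frobenius-Schur indicator\<close>

text \<open>The forms \<open>B\<close> with \<open>\<rho>(h)\<^sup>T B \<rho>(\<alpha>(h)) = B\<close> make up a space of dimension at most \<open>1\<close>, on which
  \<open>B \<mapsto> (B \<rho>(s))\<^sup>T\<close> acts as an involution, by the two conditions on \<open>\<alpha>\<close> and \<open>s\<close>. The twisted
  indicator is the trace of this involution: \<open>0\<close> if there is no such form but \<open>0\<close>, and otherwise
  \<open>\<plusminus>1\<close>. A nonzero form is exactly an isomorphism of \<open>\<rho> \<circ> \<alpha>\<close> with the dual of \<open>\<rho>\<close>, which yields the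
  second claim.\<close>

theorem twisted_frobenius_schur:
  fixes \<chi> :: "'a \<Rightarrow> complex"
  assumes fin: "finite (carrier G)" and irr: "irreducible_mat_rep G d \<rho>"
    and \<chi>: "\<And>h. h \<in> carrier G \<Longrightarrow> \<chi> h = mat_trace (\<rho> h)"
    and \<alpha>: "\<alpha> \<in> hom G G" and s: "s \<in> carrier G" and \<alpha>s: "\<alpha> s = s"
    and \<alpha>\<alpha>: "\<And>h. h \<in> carrier G \<Longrightarrow> \<alpha> (\<alpha> h) = s \<otimes> h \<otimes> inv s"
    and nz: "(\<Sum>h\<in>carrier G. \<chi> (h \<otimes> \<alpha> h \<otimes> s)) \<noteq> 0"
  shows "(\<Sum>h\<in>carrier G. \<chi> (h \<otimes> \<alpha> h \<otimes> s)) / of_nat (card (carrier G)) \<in> {1, - 1}"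
    and "\<And>h. h \<in> carrier G \<Longrightarrow> \<chi> (\<alpha> h) = cnj (\<chi> h)"
proof -
  interpret \<alpha>: group_hom G G \<alpha> by unfold_locales fact
  have rep: "mat_rep G d \<rho>" and d: "d > 0" using irr by (auto simp: irreducible_mat_rep_def)
  have r [simp]: "\<rho> g \<in> carrier_mat d d" if "g \<in> carrier G" for g
    using that by (rule mat_rep_carrier[OF rep])
  define S where "S = (\<lambda>h. (\<rho> (inv h))\<^sup>T)"
  define T where "T = \<rho> \<circ> \<alpha>"
  have surj: "\<alpha> ` carrier G = carrier G"
  proof
    show "carrier G \<subseteq> \<alpha> ` carrier G"
    proof
      fix h assume h: "h \<in> carrier G"
      have "\<alpha> (\<alpha> (inv s \<otimes> h \<otimes> s)) = s \<otimes> (inv s \<otimes> h \<otimes> s) \<otimes> inv s"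
        using h s by (intro \<alpha>\<alpha>) simp
      also have "\<dots> = (s \<otimes> inv s) \<otimes> h \<otimes> (s \<otimes> inv s)"
        using h s by (simp only: m_assoc m_closed inv_closed)
      also have "\<dots> = h" using h s by simp
      finally have "\<alpha> (\<alpha> (inv s \<otimes> h \<otimes> s)) = h" .
      moreover have "\<alpha> (inv s \<otimes> h \<otimes> s) \<in> carrier G"
        using h s by (intro \<alpha>.hom_closed) simp
      ultimately show "h \<in> \<alpha> ` carrier G" by (metis imageI)
    qed
  qed auto
  have S: "mat_rep G d S" unfolding S_def by (rule mat_rep_dual[OF rep])
  have irrT: "irreducible_mat_rep G d T" unfolding T_def by (rule irreducible_mat_rep_comp[OF irr \<alpha> surj])
  have T: "mat_rep G d T" using irrT by (simp add: irreducible_mat_rep_def)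
  have ST [simp]: "S g \<in> carrier_mat d d" "T g \<in> carrier_mat d d" if "g \<in> carrier G" for g
    using that by (auto intro: mat_rep_carrier[OF S] mat_rep_carrier[OF T])
  let ?n = "of_nat (card (carrier G)) :: complex"
  have summand: "\<chi> (h \<otimes> \<alpha> h \<otimes> s) = mat_trace (\<rho> h * T h * \<rho> s)" if "h \<in> carrier G" for h
    using that s by (simp add: \<chi> T_def mat_rep_mult[OF rep])
  \<comment> \<open>the entries of the averages of all matrix units are the entry products of which the given
    nonzero sum is a linear combination\<close>
  have "\<exists>i<d. \<exists>j<d. average d S (unit_mat d i j) T \<noteq> 0\<^sub>m d d"
  proof (rule ccontr)
    assume "\<not> ?thesis"
    then have "average d S (unit_mat d i j) T $$ (j, k) = 0" if "i < d" "j < d" "k < d" for i j k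
      using that by auto
    then have zero: "(\<Sum>h\<in>carrier G. \<rho> h $$ (i, j) * T h $$ (j, k)) = 0" if "i < d" "j < d" "k < d" for i j k
      using that average_unit_mat_index[OF S T, of i j j k]
      by (simp add: S_def carrier_matD[OF r])
    have "(\<Sum>h\<in>carrier G. \<chi> (h \<otimes> \<alpha> h \<otimes> s)) =
      (\<Sum>h\<in>carrier G. \<Sum>i<d. \<Sum>k<d. \<Sum>j<d. \<rho> h $$ (i, j) * T h $$ (j, k) * \<rho> s $$ (k, i))"
    proof (rule sum.cong[OF refl])
      fix h assume h: "h \<in> carrier G"
      have rT: "\<rho> h * T h \<in> carrier_mat d d" using h by (simp add: mult_carrier_mat[of _ d d])
      have "mat_trace (\<rho> h * T h * \<rho> s) = (\<Sum>i<d. \<Sum>k<d. (\<rho> h * T h) $$ (i, k) * \<rho> s $$ (k, i))"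
        using carrier_matD[OF r[OF h]] by (simp add: mat_trace_def mult_index[OF rT r[OF s]] del: index_mult_mat(1))
      also have "\<dots> = (\<Sum>i<d. \<Sum>k<d. \<Sum>j<d. \<rho> h $$ (i, j) * T h $$ (j, k) * \<rho> s $$ (k, i))"
        using h by (simp add: mult_index[of _ d d _ d] sum_distrib_right del: index_mult_mat(1))
      finally show "\<chi> (h \<otimes> \<alpha> h \<otimes> s) = \<dots>" using summand[OF h] by simp
    qed
    also have "\<dots> = (\<Sum>i<d. \<Sum>k<d. \<Sum>j<d. (\<Sum>h\<in>carrier G. \<rho> h $$ (i, j) * T h $$ (j, k)) * \<rho> s $$ (k, i))"
      by (simp add: sum.swap[of _ "carrier G"] sum_distrib_right)
    also have "\<dots> = 0" by (simp add: zero)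
    finally show False using nz by contradiction
  qed
  then obtain i j where "average d S (unit_mat d i j) T \<noteq> 0\<^sub>m d d" by blast
  moreover define B where "B = average d S (unit_mat d i j) T"
  ultimately have B0: "B \<noteq> 0\<^sub>m d d" by simp
  have B [simp]: "B \<in> carrier_mat d d" by (simp add: B_def)
  have SB: "S h * B = B * T h" if "h \<in> carrier G" for h
    unfolding B_def by (rule average_intertwines[OF S T unit_mat_carrier that])
  obtain C where C [simp]: "C \<in> carrier_mat d d" and BC: "B * C = 1\<^sub>m d" and CB: "C * B = 1\<^sub>m d"
    using schur_isomorphism[where S = S, OF irrT B ST(1) SB B0] by metis
  show conj: "\<chi> (\<alpha> h) = cnj (\<chi> h)" if h: "h \<in> carrier G" for h
  proof -
    have "\<chi> (\<alpha> h) = mat_trace (T h)" using h by (simp add: \<chi> T_def)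
    also have "\<dots> = mat_trace (S h)"
      using h by (intro mat_trace_similar[OF B C BC CB _ _ SB, symmetric]) simp_all
    also have "\<dots> = cnj (\<chi> h)"
      using h by (simp add: S_def mat_trace_transpose[of _ d] mat_trace_rep_inv[OF fin irr] \<chi>)
    finally show ?thesis .
  qed
  note mc [simp] = mult_carrier_mat[of _ d d _ d]
  note assoc = assoc_mult_mat[of _ d d _ d _ d]
  have canBC: "B * (C * X) = X" "C * (B * X) = X" if "X \<in> carrier_mat d d" for X
    using that by (simp_all add: BC CB flip: assoc)
  have tr: "(X * Y)\<^sup>T = Y\<^sup>T * X\<^sup>T" if "X \<in> carrier_mat d d" "Y \<in> carrier_mat d d" for X Y :: "complex mat"
    using that by (rule transpose_mult)
  have canBCt: "C\<^sup>T * (B\<^sup>T * X) = X" "B\<^sup>T * (C\<^sup>T * X) = X" if "X \<in> carrier_mat d d" for X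
    using that by (simp_all add: BC CB flip: assoc tr)
  have T_eq: "T h = C * S h * B" if "h \<in> carrier G" for h
    using that by (simp add: assoc SB canBC)
  \<comment> \<open>\<open>D\<close> compares the form \<open>B\<close> with its twisted transpose: \<open>B \<rho>(s) = B\<^sup>T D\<close>\<close>
  define D where "D = C\<^sup>T * B * \<rho> s"
  have D [simp]: "D \<in> carrier_mat d d" using s by (simp add: D_def)
  \<comment> \<open>expanding \<open>\<rho> \<circ> \<alpha>\<close> twice in terms of the dual gives back \<open>\<rho>\<close>, conjugated both by \<open>\<rho>(s)\<close> and by
    \<open>B\<^sup>-\<^sup>1 B\<^sup>T\<close>\<close>
  have "\<rho> h * D = D * \<rho> h" if h: "h \<in> carrier G" for h
  proof -
    have "T (inv h) = C * (\<rho> h)\<^sup>T * B" using T_eq[of "inv h"] h by (simp add: S_def)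
    then have "(T (inv h))\<^sup>T = B\<^sup>T * \<rho> h * C\<^sup>T" using h by (simp add: tr assoc)
    moreover have "T (\<alpha> h) = C * (T (inv h))\<^sup>T * B"
      using T_eq[of "\<alpha> h"] h by (simp add: S_def T_def)
    ultimately have "\<rho> (s \<otimes> h \<otimes> inv s) = C * (B\<^sup>T * \<rho> h * C\<^sup>T) * B"
      using h by (simp add: T_def \<alpha>\<alpha>)
    then have "\<rho> (s \<otimes> h \<otimes> inv s) * \<rho> s = C * (B\<^sup>T * (\<rho> h * D))"
      using h s by (simp add: assoc D_def)
    moreover have "\<rho> (s \<otimes> h \<otimes> inv s) * \<rho> s = \<rho> s * \<rho> h"
      using h s by (simp add: m_assoc flip: mat_rep_mult[OF rep])
    ultimately have "D * \<rho> h = C\<^sup>T * (B * (C * (B\<^sup>T * (\<rho> h * D))))"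
      using h s by (simp add: D_def assoc)
    then show ?thesis using h by (simp add: canBC canBCt)
  qed
  then obtain c where c: "D = c \<cdot>\<^sub>m 1\<^sub>m d"
    using schur_scalar[OF irr D] by metis
  \<comment> \<open>transposing \<open>B \<rho>(s) = c B\<^sup>T\<close>, and moving \<open>s = \<alpha>(s)\<close> across \<open>B\<close> on the other hand, gives
    \<open>B\<^sup>T = c\<^sup>2 B\<^sup>T\<close>\<close>
  have "c * c = 1"
  proof -
    have "B * \<rho> s = B\<^sup>T * D" using s by (simp add: D_def assoc canBCt)
    then have cB: "B * \<rho> s = c \<cdot>\<^sub>m B\<^sup>T"
      by (simp add: c mult_smult_distrib[of _ d d _ d] right_mult_one_mat[of _ d d])
    then have "(\<rho> s)\<^sup>T * B\<^sup>T = c \<cdot>\<^sub>m B" using s by (simp flip: tr) (auto intro!: eq_matI simp: carrier_matD[OF B])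
    then have "(\<rho> (inv s))\<^sup>T * ((\<rho> s)\<^sup>T * B\<^sup>T) = c \<cdot>\<^sub>m (S s * B)"
      using s by (simp add: S_def mult_smult_distrib[of _ d d _ d])
    moreover have "(\<rho> (inv s))\<^sup>T * ((\<rho> s)\<^sup>T * B\<^sup>T) = B\<^sup>T"
    proof -
      have "(\<rho> (inv s))\<^sup>T * (\<rho> s)\<^sup>T = 1\<^sub>m d"
        using s by (simp add: mat_rep_one[OF rep] flip: tr mat_rep_mult[OF rep])
      then show ?thesis using s by (simp add: left_mult_one_mat[of _ d d] flip: assoc)
    qed
    moreover have "S s * B = c \<cdot>\<^sub>m B\<^sup>T"
      using SB[OF s] cB by (simp add: T_def \<alpha>s)
    ultimately have BB: "B\<^sup>T = c \<cdot>\<^sub>m (c \<cdot>\<^sub>m B\<^sup>T)" by simp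
    obtain a b where ab: "a < d" "b < d" "B $$ (a, b) \<noteq> 0"
      using B0 B by (metis carrier_matD eq_matI index_zero_mat)
    have "B\<^sup>T $$ (b, a) = (c \<cdot>\<^sub>m (c \<cdot>\<^sub>m B\<^sup>T)) $$ (b, a)" using BB by simp
    then have "B $$ (a, b) = c * c * B $$ (a, b)" using ab carrier_matD[OF B] by simp
    then show ?thesis using ab by simp
  qed
  then have "c \<in> {1, -1}" by (metis insertCI square_eq_1_iff)
  \<comment> \<open>the second factor is transposed, so orthogonality turns the average of \<open>C\<close> into a multiple of
    \<open>C\<^sup>T\<close> and not into a scalar matrix\<close>
  have twist: "mat_sum d (carrier G) (\<lambda>h. \<rho> h * C * S h) = (?n / of_nat d) \<cdot>\<^sub>m C\<^sup>T"
  proof (rule eq_matI)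
    fix i l assume "i < dim_row ((?n / of_nat d) \<cdot>\<^sub>m C\<^sup>T)" "l < dim_col ((?n / of_nat d) \<cdot>\<^sub>m C\<^sup>T)"
    then have il: "i < d" "l < d" using carrier_matD[OF C] by auto
    have "mat_sum d (carrier G) (\<lambda>h. \<rho> h * C * S h) $$ (i, l) =
      (\<Sum>h\<in>carrier G. \<Sum>k<d. \<Sum>j<d. C $$ (j, k) * (\<rho> (inv h) $$ (l, k) * \<rho> h $$ (i, j)))"
      using il by (auto intro!: sum.cong simp: mult_index[of _ d d _ d] S_def carrier_matD[OF r] sum_distrib_right
          simp del: index_mult_mat(1))
    also have "\<dots> = (\<Sum>k<d. \<Sum>j<d. C $$ (j, k) * (\<Sum>h\<in>carrier G. \<rho> (inv h) $$ (l, k) * \<rho> h $$ (i, j)))"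
      by (simp add: sum.swap[of _ "carrier G"] sum_distrib_left)
    also have "\<dots> = (\<Sum>k<d. \<Sum>j<d. if j = l then (if k = i then C $$ (l, i) * (?n / of_nat d) else 0) else 0)"
      using il by (intro sum.cong refl) (auto simp: schur_orthogonality[OF irr])
    also have "\<dots> = (\<Sum>k<d. if k = i then C $$ (l, i) * (?n / of_nat d) else 0)"
      using il by simp
    also have "\<dots> = ((?n / of_nat d) \<cdot>\<^sub>m C\<^sup>T) $$ (i, l)"
      using il carrier_matD[OF C] by simp
    finally show "mat_sum d (carrier G) (\<lambda>h. \<rho> h * C * S h) $$ (i, l) = ((?n / of_nat d) \<cdot>\<^sub>m C\<^sup>T) $$ (i, l)" .
  qed (use carrier_matD[OF C] in simp_all)
  have "mat_sum d (carrier G) (\<lambda>h. \<rho> h * T h * \<rho> s) = mat_sum d (carrier G) (\<lambda>h. \<rho> h * C * S h * (B * \<rho> s))"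
    using s by (intro mat_sum_cong) (simp add: T_eq assoc)
  also have "\<dots> = mat_sum d (carrier G) (\<lambda>h. \<rho> h * C * S h) * (B * \<rho> s)"
    using s by (intro mat_sum_mult[symmetric]) simp_all
  also have "\<dots> = (?n / of_nat d) \<cdot>\<^sub>m D"
    using s by (simp add: twist D_def assoc mult_smult_assoc_mat[of _ d d _ d])
  finally have sum_eq: "mat_sum d (carrier G) (\<lambda>h. \<rho> h * T h * \<rho> s) = (?n / of_nat d) \<cdot>\<^sub>m D" .
  have "(\<Sum>h\<in>carrier G. \<chi> (h \<otimes> \<alpha> h \<otimes> s)) = mat_trace (mat_sum d (carrier G) (\<lambda>h. \<rho> h * T h * \<rho> s))"
    using s by (subst mat_trace_mat_sum) (simp_all add: summand)
  also have "\<dots> = ?n * c"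
    using d unfolding sum_eq by (simp add: c mat_trace_def)
  finally have "(\<Sum>h\<in>carrier G. \<chi> (h \<otimes> \<alpha> h \<otimes> s)) / ?n = c"
    using fin by (simp add: card_eq_0_iff carrier_not_empty)
  with \<open>c \<in> {1, -1}\<close> show "(\<Sum>h\<in>carrier G. \<chi> (h \<otimes> \<alpha> h \<otimes> s)) / ?n \<in> {1, - 1}"
    by simp
qed


section \<open>Reduction to involutions of the quotient\<close>

text \<open>For each of the \<open>|G|\<close> conjugating elements \<open>x\<close> in the induced character, the substitution
  \<open>h \<mapsto> xhx\<inverse>\<close> gives the same sum over \<open>h\<close>, which cancels the factor \<open>1/|G|\<close>.\<close>

lemma fs_indicator_induced_char:
  assumes fin: "finite (carrier G)"
  shows "fs_indicator G (induced_char G N \<theta>) =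
    (\<Sum>g | g \<in> carrier G \<and> g [^] (2::nat) \<in> N. \<theta> (g [^] (2::nat))) / of_nat (card N)"
proof -
  define F where "F = (\<lambda>y. if y \<in> N then \<theta> y else 0)"
  have "(\<Sum>h\<in>carrier G. \<Sum>x\<in>carrier G. F (x \<otimes> h [^] (2::nat) \<otimes> inv x)) =
    (\<Sum>x\<in>carrier G. \<Sum>h\<in>carrier G. F (x \<otimes> h [^] (2::nat) \<otimes> inv x))"
    by (rule sum.swap)
  also have "\<dots> = (\<Sum>x\<in>carrier G. \<Sum>h\<in>carrier G. F (h [^] (2::nat)))"
  proof (rule sum.cong[OF refl])
    fix x assume x: "x \<in> carrier G"
    show "(\<Sum>h\<in>carrier G. F (x \<otimes> h [^] (2::nat) \<otimes> inv x)) = (\<Sum>h\<in>carrier G. F (h [^] (2::nat)))"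
    proof (rule sum.reindex_bij_witness[of _ "\<lambda>h. inv x \<otimes> h \<otimes> x" "\<lambda>h. x \<otimes> h \<otimes> inv x"])
      fix h assume h: "h \<in> carrier G"
      have cancel: "inv x \<otimes> (x \<otimes> y) = y" "x \<otimes> (inv x \<otimes> y) = y" if "y \<in> carrier G" for y
        using that x by (simp_all flip: m_assoc)
      show "inv x \<otimes> (x \<otimes> h \<otimes> inv x) \<otimes> x = h" "x \<otimes> (inv x \<otimes> h \<otimes> x) \<otimes> inv x = h"
        using h x by (simp_all add: m_assoc cancel)
      show "F ((x \<otimes> h \<otimes> inv x) [^] (2::nat)) = F (x \<otimes> h [^] (2::nat) \<otimes> inv x)"
        using h x by (simp add: numeral_2_eq_2 m_assoc cancel)
    qed (use x in auto)
  qed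
  also have "\<dots> = of_nat (card (carrier G)) * (\<Sum>h\<in>carrier G. F (h [^] (2::nat)))"
    by simp
  also have "(\<Sum>h\<in>carrier G. F (h [^] (2::nat))) =
      (\<Sum>g | g \<in> carrier G \<and> g [^] (2::nat) \<in> N. \<theta> (g [^] (2::nat)))"
    unfolding F_def by (simp add: sum.inter_filter[OF fin, symmetric])
  finally show ?thesis
    using fin by (simp add: fs_indicator_def induced_char_def Let_def F_def[symmetric] card_eq_0_iff
        carrier_not_empty flip: sum_divide_distrib)
qed

end

context normal
begin

lemma rcos_self_iff: "g \<in> carrier G \<Longrightarrow> t \<in> carrier G \<Longrightarrow> H #> g = H #> t \<longleftrightarrow> g \<in> H #> t"
  using repr_independence[OF _ _ is_subgroup] rcos_self[OF _ is_subgroup] by metis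

text \<open>Being an involution of the quotient does not depend on the representative, because
  \<open>(ht)\<^sup>2 = h (tht\<inverse>) t\<^sup>2\<close>.\<close>

lemma square_mem_rcos_iff:
  assumes t: "t \<in> carrier G" and g: "g \<in> H #> t"
  shows "g [^] (2::nat) \<in> H \<longleftrightarrow> t [^] (2::nat) \<in> H"
proof -
  from g obtain h where h: "h \<in> H" "g = h \<otimes> t" by (auto simp: r_coset_def)
  have "g [^] (2::nat) = (h \<otimes> (t \<otimes> h \<otimes> inv t)) \<otimes> t [^] (2::nat)"
  proof -
    have "inv t \<otimes> (t \<otimes> t) = t" using t by (simp flip: m_assoc)
    then show ?thesis using h(2) t mem_carrier[OF h(1)] by (simp add: numeral_2_eq_2 m_assoc)
  qed
  moreover have k: "h \<otimes> (t \<otimes> h \<otimes> inv t) \<in> H" (is "?k \<in> H")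
    by (rule subgroup.m_closed[OF is_subgroup h(1) inv_op_closed2[OF t h(1)]])
  moreover have "?k \<otimes> y \<in> H \<longleftrightarrow> y \<in> H" if y: "y \<in> carrier G" for y
  proof
    assume "?k \<otimes> y \<in> H"
    then have "inv ?k \<otimes> (?k \<otimes> y) \<in> H"
      by (rule subgroup.m_closed[OF is_subgroup subgroup.m_inv_closed[OF is_subgroup k]])
    then show "y \<in> H"
      using y mem_carrier[OF k] by (simp only: m_assoc[symmetric] inv_closed l_inv l_one)
  qed (rule subgroup.m_closed[OF is_subgroup k])
  ultimately show ?thesis using t by simp
qed

text \<open>The square of the coset of \<open>t\<close>, computed with the multiplication of cosets in \<open>G\<close>, is the coset of
  \<open>t\<^sup>2\<close>, and the Gow indicator is constant on cosets; so any representative can be tested.\<close>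

lemma typed_involutions_eq:
  assumes K: "K \<subseteq> carrier G"
  shows "typed_involutions G H \<theta> K \<epsilon> =
    {H #> t | t. t \<in> K \<and> t [^] (2::nat) \<in> H \<and> gow_indicator G H \<theta> t = \<epsilon>}"
proof -
  let ?Q = "G\<lparr>carrier := K\<rparr> Mod H"
  have car: "carrier ?Q = {H #> t | t. t \<in> K}"
    by (auto simp: FactGroup_def RCOSETS_def r_coset_def)
  have sq: "(H #> t) [^]\<^bsub>?Q\<^esub> (2::nat) = \<one>\<^bsub>?Q\<^esub> \<longleftrightarrow> t [^] (2::nat) \<in> H" if "t \<in> K" for t
  proof -
    have t: "t \<in> carrier G" using that K by auto
    have sm: "set_mult (G\<lparr>carrier := K\<rparr>) = set_mult G"
      by (auto simp: set_mult_def fun_eq_iff)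
    have "(H #> t) [^]\<^bsub>?Q\<^esub> (2::nat) = H <#> (H #> t) <#> (H #> t)"
      by (simp add: nat_pow_def numeral_2_eq_2 FactGroup_def sm)
    also have "\<dots> = H #> t [^] (2::nat)"
      using t by (simp add: rcosets_mult_eq[OF rcosetsI[OF subset t]] rcos_sum numeral_2_eq_2)
    finally have "(H #> t) [^]\<^bsub>?Q\<^esub> (2::nat) = H #> t [^] (2::nat)" .
    moreover have "H #> t [^] (2::nat) = H \<longleftrightarrow> t [^] (2::nat) \<in> H"
        using coset_join1[OF _ _ is_subgroup] coset_join2[OF _ is_subgroup] t by blast
    ultimately show ?thesis by (simp add: FactGroup_def)
  qed
  have gow: "(\<exists>g\<in>H #> t. gow_indicator G H \<theta> g = \<epsilon>) \<longleftrightarrow> gow_indicator G H \<theta> t = \<epsilon>" if "t \<in> K" for t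
  proof -
    have t: "t \<in> carrier G" using that K by auto
    have "gow_indicator G H \<theta> g = gow_indicator G H \<theta> t" if "g \<in> H #> t" for g
    proof -
      from that obtain m where m: "m \<in> H" "g = m \<otimes> t" by (auto simp: r_coset_def)
      show ?thesis unfolding m(2) by (rule gow_indicator_coset[OF is_subgroup t m(1)])
    qed
    then show ?thesis using rcos_self[OF t is_subgroup] by metis
  qed
  show ?thesis
  proof (intro subset_antisym subsetI)
    fix T assume "T \<in> typed_involutions G H \<theta> K \<epsilon>"
    then obtain t where "t \<in> K" "T = H #> t" "T [^]\<^bsub>?Q\<^esub> (2::nat) = \<one>\<^bsub>?Q\<^esub>"
        "\<exists>g\<in>T. gow_indicator G H \<theta> g = \<epsilon>"
      unfolding typed_involutions_def car by blast
    then show "T \<in> {H #> t | t. t \<in> K \<and> t [^] (2::nat) \<in> H \<and> gow_indicator G H \<theta> t = \<epsilon>}"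
      using sq gow by blast
  next
    fix T assume "T \<in> {H #> t | t. t \<in> K \<and> t [^] (2::nat) \<in> H \<and> gow_indicator G H \<theta> t = \<epsilon>}"
    then show "T \<in> typed_involutions G H \<theta> K \<epsilon>"
      unfolding typed_involutions_def car using sq gow by blast
  qed
qed

lemma sum_square_cosets:
  fixes F :: "'a \<Rightarrow> complex"
  assumes fin: "finite (carrier G)"
  shows "(\<Sum>g | g \<in> carrier G \<and> g [^] (2::nat) \<in> H. F g) =
    (\<Sum>T\<in>{H #> t | t. t \<in> carrier G \<and> t [^] (2::nat) \<in> H}. \<Sum>g\<in>T. F g)"
proof -
  let ?A = "{g \<in> carrier G. g [^] (2::nat) \<in> H}"
  let ?I = "{H #> t | t. t \<in> carrier G \<and> t [^] (2::nat) \<in> H}"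
  have I: "?I = (\<lambda>t. H #> t) ` ?A" by auto
  have "sum F ?A = (\<Sum>T\<in>?I. sum F {g \<in> ?A. H #> g = T})"
    by (rule sum.group[symmetric]) (use fin in \<open>auto simp: I\<close>)
  also have "\<dots> = (\<Sum>T\<in>?I. sum F T)"
  proof (rule sum.cong[OF refl])
    fix T assume "T \<in> ?I"
    then obtain t where t: "t \<in> carrier G" "t [^] (2::nat) \<in> H" "T = H #> t" by auto
    have "{g \<in> ?A. H #> g = T} = T"
      using t square_mem_rcos_iff[OF t(1)] rcos_self_iff[OF _ t(1)] r_coset_subset_G[OF subset t(1)]
      by auto
    then show "sum F {g \<in> ?A. H #> g = T} = sum F T" by simp
  qed
  finally show ?thesis .
qed

lemma sum_rcos_gow_indicator:
  assumes t: "t \<in> carrier G"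
  shows "(\<Sum>g\<in>H #> t. \<theta> (g [^] (2::nat))) / of_nat (card H) = gow_indicator G H \<theta> t"
proof -
  have "inj_on (\<lambda>n. n \<otimes> t) H" using t by (auto simp: inj_on_def)
  moreover have "H #> t = (\<lambda>n. n \<otimes> t) ` H" by (auto simp: r_coset_def)
  ultimately show ?thesis by (simp add: gow_indicator_def sum.reindex)
qed

text \<open>The twisted theorem for \<open>N\<close>, with conjugation by \<open>t\<close> as the automorphism and \<open>s = t\<^sup>2\<close>.\<close>

lemma gow_indicator_nonzero:
  assumes fin: "finite (carrier G)" and \<theta>: "irreducible_character (G\<lparr>carrier := H\<rparr>) \<theta>"
    and t: "t \<in> carrier G" "t [^] (2::nat) \<in> H" and nz: "gow_indicator G H \<theta> t \<noteq> 0"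
  shows "gow_indicator G H \<theta> t \<in> {1, - 1}" and "t \<in> ext_inertia G H \<theta>"
proof -
  let ?H = "G\<lparr>carrier := H\<rparr>"
  interpret H: group ?H by (rule subgroup_is_group[OF is_group])
  obtain d \<rho> where irr: "irreducible_mat_rep ?H d \<rho>" and \<chi>: "\<And>h. h \<in> H \<Longrightarrow> \<theta> h = mat_trace (\<rho> h)"
    using \<theta> by (auto simp: irreducible_character_def)
  define s where "s = t [^] (2::nat)"
  define \<alpha> where "\<alpha> = (\<lambda>h. t \<otimes> h \<otimes> inv t)"
  have s: "s \<in> H" using t by (simp add: s_def)
  have cancel: "inv t \<otimes> (t \<otimes> y) = y" "t \<otimes> (inv t \<otimes> y) = y" if "y \<in> carrier G" for y
    using that t by (simp_all flip: m_assoc)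
  have \<alpha>H: "\<alpha> h \<in> H" if "h \<in> H" for h
    unfolding \<alpha>_def using inv_op_closed2[OF t(1) that] .
  have hom: "\<alpha> \<in> hom ?H ?H"
  proof (rule homI)
    fix x y assume "x \<in> carrier ?H" "y \<in> carrier ?H"
    then have "x \<in> carrier G" "y \<in> carrier G" using subset by auto
    then show "\<alpha> (x \<otimes>\<^bsub>?H\<^esub> y) = \<alpha> x \<otimes>\<^bsub>?H\<^esub> \<alpha> y"
      using t(1) by (simp add: \<alpha>_def m_assoc cancel)
  qed (use \<alpha>H in simp)
  have \<alpha>s: "\<alpha> s = s" using t(1) by (simp add: \<alpha>_def s_def numeral_2_eq_2 m_assoc)
  have \<alpha>\<alpha>: "\<alpha> (\<alpha> h) = s \<otimes>\<^bsub>?H\<^esub> h \<otimes>\<^bsub>?H\<^esub> inv\<^bsub>?H\<^esub> s" if "h \<in> H" for h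
    using that t s by (simp add: m_inv_consistent[OF is_subgroup s])
      (simp add: \<alpha>_def s_def numeral_2_eq_2 m_assoc inv_mult_group)
  have "(h \<otimes> t) [^] (2::nat) = h \<otimes> \<alpha> h \<otimes> s" if "h \<in> H" for h
    using that t by (simp add: \<alpha>_def s_def numeral_2_eq_2 m_assoc cancel)
  then have gow: "gow_indicator G H \<theta> t = (\<Sum>h\<in>H. \<theta> (h \<otimes> \<alpha> h \<otimes> s)) / of_nat (card H)"
    by (simp add: gow_indicator_def)
  have finH: "finite H" using fin subset by (rule finite_subset[rotated])
  have nz': "(\<Sum>h\<in>H. \<theta> (h \<otimes> \<alpha> h \<otimes> s)) \<noteq> 0" using nz gow by auto
  note twisted = H.twisted_frobenius_schur[of d \<rho> \<theta> \<alpha> s, simplified, OF finH irr \<chi> hom s \<alpha>s \<alpha>\<alpha>[simplified] nz']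
  show "gow_indicator G H \<theta> t \<in> {1, - 1}" using twisted(1) gow finH by (simp add: card_gt_0_iff)
  show "t \<in> ext_inertia G H \<theta>"
    using twisted(2) t by (auto simp: ext_inertia_def conj_char_def \<alpha>_def)
qed

end

theorem theorem2:
  fixes G :: "('a, 'b) monoid_scheme" and N :: "'a set" and \<theta> :: "'a \<Rightarrow> complex"
  assumes "group G" and "finite (carrier G)"
    and "N \<lhd> G"
    and "irreducible_character (G\<lparr>carrier := N\<rparr>) \<theta>"
    and "\<exists>g\<in>carrier G. \<forall>n\<in>N. conj_char G \<theta> g n = cnj (\<theta> n)"
  shows "fs_indicator G (induced_char G N \<theta>) =
           of_nat (card (typed_involutions G N \<theta> (ext_inertia G N \<theta>) 1)) -
           of_nat (card (typed_involutions G N \<theta> (ext_inertia G N \<theta>) (- 1)))"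
proof -
  interpret normal N G by fact
  note fin = assms(2)
  define I where "I = {N #>\<^bsub>G\<^esub> t | t. t \<in> carrier G \<and> t [^]\<^bsub>G\<^esub> (2::nat) \<in> N}"
  \<comment> \<open>the Gow indicator as a function of the coset, free of a choice of representative\<close>
  define \<gamma> where "\<gamma> T = (\<Sum>g\<in>T. \<theta> (g [^]\<^bsub>G\<^esub> (2::nat))) / of_nat (card N)" for T
  have \<gamma>: "\<gamma> (N #>\<^bsub>G\<^esub> t) = gow_indicator G N \<theta> t" if "t \<in> carrier G" for t
    unfolding \<gamma>_def by (rule sum_rcos_gow_indicator[OF that])
  have finI: "finite I" unfolding I_def using fin by simp
  have typed: "typed_involutions G N \<theta> (ext_inertia G N \<theta>) \<epsilon> = {T \<in> I. \<gamma> T = \<epsilon>}" if "\<epsilon> \<noteq> 0" for \<epsilon>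
  proof -
    have K: "ext_inertia G N \<theta> \<subseteq> carrier G" by (auto simp: ext_inertia_def)
    show ?thesis
      unfolding typed_involutions_eq[OF K] I_def
      using K \<gamma> gow_indicator_nonzero(2)[OF fin assms(4)] that by auto
  qed
  have val: "\<gamma> T \<in> {0, 1, - 1}" if "T \<in> I" for T
  proof -
    from that obtain t where t: "t \<in> carrier G" "t [^]\<^bsub>G\<^esub> (2::nat) \<in> N" "T = N #>\<^bsub>G\<^esub> t"
      by (auto simp: I_def)
    then show ?thesis
      using gow_indicator_nonzero(1)[OF fin assms(4) t(1,2)] by (cases "gow_indicator G N \<theta> t = 0") (auto simp: \<gamma>)
  qed
  have "fs_indicator G (induced_char G N \<theta>) = (\<Sum>T\<in>I. \<gamma> T)"
    by (simp add: fs_indicator_induced_char[OF fin] sum_square_cosets[OF fin] I_def \<gamma>_def sum_divide_distrib)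
  also have "\<dots> = (\<Sum>T\<in>I. (if \<gamma> T = 1 then 1 else 0) - (if \<gamma> T = - 1 then 1 else 0))"
    using val by (intro sum.cong refl) force
  also have "\<dots> = of_nat (card {T \<in> I. \<gamma> T = 1}) - of_nat (card {T \<in> I. \<gamma> T = - 1})"
    by (simp add: sum_subtractf finI flip: sum.inter_filter)
  finally show ?thesis by (simp add: typed)
qed

end
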